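(* Let $\Delta$ be a simplicial tree on a vertex set $V$ and let $\mathcal{X}\subseteq V$. Then the induced subcomplex $\Delta_{\mathcal{X}}=\{F\in\Delta : F\subseteq \mathcal{X}\}$ is a simplicial forest.
   Context: A simplicial complex $\Delta$ on a finite vertex set $V=\{v_1,\ldots,v_n\}$ is a collection of subsets of $V$ (faces), closed under taking subsets, with $\{v_i\}\in\Delta$ for all $i$. Facets are the faces maximal under inclusion. A subcollection of $\Delta$ is a simplicial complex generated by a subset of the set of facets of $\Delta$. A facet $F$ of a simplicial complex is a leaf if either it is the only facet, or there is a facet $G\neq F$ such that $F\cap H\subseteq G$ for every facet $H\neq F$. A simplicial complex is a simplicial forest if every nonempty subcollection (i.e. generated by a nonempty set of facets) has a leaf; a simplicial tree is a connected simplicial complex with this property. *)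

theory Defs
  imports Main
begin

text \<open>
  Abstract simplicial complexes, given by their set of faces together with an explicit finite
  vertex set. The empty set is treated like any other face; in particular it is the unique facet
  of the complex \<open>{{}}\<close>.
\<close>

definition simplicial_complex_on :: "'a set \<Rightarrow> 'a set set \<Rightarrow> bool" where
  "simplicial_complex_on V \<Delta> \<longleftrightarrow>
     finite V \<and> \<Delta> \<subseteq> Pow V \<and> (\<forall>F\<in>\<Delta>. \<forall>G. G \<subseteq> F \<longrightarrow> G \<in> \<Delta>) \<and> (\<forall>v\<in>V. {v} \<in> \<Delta>)"

definition facets :: "'a set set \<Rightarrow> 'a set set" where
  "facets \<Delta> = {F \<in> \<Delta>. \<forall>G\<in>\<Delta>. F \<subseteq> G \<longrightarrow> F = G}"

definition generated_complex :: "'a set set \<Rightarrow> 'a set set" where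
  "generated_complex S = {F. \<exists>G\<in>S. F \<subseteq> G}"

definition leaf :: "'a set set \<Rightarrow> 'a set \<Rightarrow> bool" where
  "leaf \<Delta> F \<longleftrightarrow> F \<in> facets \<Delta> \<and>
     (facets \<Delta> = {F} \<or>
      (\<exists>G\<in>facets \<Delta>. G \<noteq> F \<and> (\<forall>H\<in>facets \<Delta>. H \<noteq> F \<longrightarrow> F \<inter> H \<subseteq> G)))"

definition simplicial_forest :: "'a set \<Rightarrow> 'a set set \<Rightarrow> bool" where
  "simplicial_forest V \<Delta> \<longleftrightarrow> simplicial_complex_on V \<Delta> \<and>
     (\<forall>S. S \<subseteq> facets \<Delta> \<and> S \<noteq> {} \<longrightarrow> (\<exists>F. leaf (generated_complex S) F))"

text \<open>
  A complex is connected if any two facets are joined by a chain of facets in which consecutive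
  ones intersect. Chains of length zero are allowed, so a complex with a single facet is connected.
\<close>

definition connected_complex :: "'a set set \<Rightarrow> bool" where
  "connected_complex \<Delta> \<longleftrightarrow>
     (\<forall>F\<in>facets \<Delta>. \<forall>G\<in>facets \<Delta>.
        (\<lambda>A B. A \<in> facets \<Delta> \<and> B \<in> facets \<Delta> \<and> A \<inter> B \<noteq> {})\<^sup>*\<^sup>* F G)"

definition simplicial_tree :: "'a set \<Rightarrow> 'a set set \<Rightarrow> bool" where
  "simplicial_tree V \<Delta> \<longleftrightarrow> simplicial_forest V \<Delta> \<and> connected_complex \<Delta>"

definition induced_subcomplex :: "'a set set \<Rightarrow> 'a set \<Rightarrow> 'a set set" where
  "induced_subcomplex \<Delta> X = {F \<in> \<Delta>. F \<subseteq> X}"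

end

(* A facet F of the induced subcomplex extends to a facet f F of the whole complex, and
   maximality forces F = f F \<inter> X. So f is injective and F \<inter> H = f F \<inter> f H \<inter> X: intersecting
   with X turns a leaf of the subcollection f ` S, with its joint, into a leaf of S. *)
theory Submission
  imports Defs
begin

text \<open>Facets of \<Delta> are pairwise incomparable, so no member of \<open>S\<close> is
  swallowed by another in the complex they generate. This lets the leaf condition for a
  subcollection be read on \<open>S\<close> itself.\<close>

lemma facets_generated_complex:
  assumes "S \<subseteq> facets \<Delta>"
  shows "facets (generated_complex S) = S"
proof -
  have antichain: "F = G" if "F \<in> S" "G \<in> S" "F \<subseteq> G" for F G
    using assms that unfolding facets_def by blast
  show ?thesis
  proof (intro equalityI subsetI)
    fix F assume F: "F \<in> facets (generated_complex S)"
    then obtain G where G: "G \<in> S" "F \<subseteq> G"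
      unfolding facets_def generated_complex_def by blast
    then have "G \<in> generated_complex S"
      unfolding generated_complex_def by blast
    with F G show "F \<in> S"
      unfolding facets_def by auto
  next
    fix F assume F: "F \<in> S"
    \<comment> \<open>\<open>H\<close> is squeezed between \<open>F\<close> and some
      \<open>G\<close> in \<open>S\<close>, and the antichain property collapses the chain.\<close>
    have "F = H" if H: "H \<in> generated_complex S" "F \<subseteq> H" for H
    proof -
      obtain G where "G \<in> S" "H \<subseteq> G"
        using H(1) unfolding generated_complex_def by blast
      then show ?thesis
        using antichain[OF F] H(2) by blast
    qed
    with F show "F \<in> facets (generated_complex S)"
      unfolding facets_def generated_complex_def by blast
  qed
qed

text \<open>\<Delta> lies in the power set of the finite set \<open>V\<close>, so it is finite, and
  above any face there is a maximal one.\<close>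

lemma face_subset_facet:
  assumes "simplicial_complex_on V \<Delta>" and "F \<in> \<Delta>"
  obtains G where "G \<in> facets \<Delta>" "F \<subseteq> G"
proof -
  have "finite \<Delta>"
    using assms(1) unfolding simplicial_complex_on_def by (meson finite_Pow_iff finite_subset)
  then obtain G where "G \<in> \<Delta>" "F \<subseteq> G" "\<forall>H\<in>\<Delta>. G \<subseteq> H \<longrightarrow> G = H"
    using finite_has_maximal2[OF _ assms(2)] by metis
  then show thesis
    using that unfolding facets_def by blast
qed

lemma simplicial_complex_on_induced:
  assumes "simplicial_complex_on V \<Delta>" and "X \<subseteq> V"
  shows "simplicial_complex_on X (induced_subcomplex \<Delta> X)"
  unfolding simplicial_complex_on_def
proof (intro conjI)
  show "finite X"
    using assms finite_subset unfolding simplicial_complex_on_def by metis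
  show "\<forall>F\<in>induced_subcomplex \<Delta> X. \<forall>G. G \<subseteq> F \<longrightarrow> G \<in> induced_subcomplex \<Delta> X"
  proof (intro ballI allI impI)
    fix F G assume F: "F \<in> induced_subcomplex \<Delta> X" and G: "G \<subseteq> F"
    then have "F \<in> \<Delta>" "G \<subseteq> X"
      unfolding induced_subcomplex_def by auto
    moreover from this have "G \<in> \<Delta>"
      using assms(1) G unfolding simplicial_complex_on_def by metis
    ultimately show "G \<in> induced_subcomplex \<Delta> X"
      unfolding induced_subcomplex_def by simp
  qed
  show "induced_subcomplex \<Delta> X \<subseteq> Pow X"
    unfolding induced_subcomplex_def by blast
  show "\<forall>v\<in>X. {v} \<in> induced_subcomplex \<Delta> X"
    using assms unfolding simplicial_complex_on_def induced_subcomplex_def by auto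
qed

lemma facet_induced_extends:
  assumes "simplicial_complex_on V \<Delta>" and "F \<in> facets (induced_subcomplex \<Delta> X)"
  obtains G where "G \<in> facets \<Delta>" "G \<inter> X = F"
proof -
  have F: "F \<in> \<Delta>" "F \<subseteq> X"
    using assms(2) unfolding facets_def induced_subcomplex_def by auto
  obtain G where G: "G \<in> facets \<Delta>" "F \<subseteq> G"
    using face_subset_facet[OF assms(1) F(1)] .
  \<comment> \<open>The trace of \<open>G\<close> on \<open>X\<close> is a face because \<Delta> is
    closed under subsets; it contains \<open>F\<close>, so maximality of \<open>F\<close> can be
    applied to it.\<close>
  then have "G \<inter> X \<in> induced_subcomplex \<Delta> X"
    using assms(1) unfolding simplicial_complex_on_def facets_def induced_subcomplex_def by blast
  moreover have "F \<subseteq> G \<inter> X"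
    using F(2) G(2) by blast
  ultimately have "G \<inter> X = F"
    using assms(2) unfolding facets_def by auto
  with G(1) show thesis
    by (rule that)
qed

lemma simplicial_forest_induced:
  assumes "simplicial_forest V \<Delta>" and "X \<subseteq> V"
  shows "simplicial_forest X (induced_subcomplex \<Delta> X)"
  unfolding simplicial_forest_def
proof (intro conjI allI impI)
  have complex: "simplicial_complex_on V \<Delta>"
    using assms(1) unfolding simplicial_forest_def by blast
  then show "simplicial_complex_on X (induced_subcomplex \<Delta> X)"
    using assms(2) by (rule simplicial_complex_on_induced)
  fix S assume S: "S \<subseteq> facets (induced_subcomplex \<Delta> X) \<and> S \<noteq> {}"
  \<comment> \<open>One extension is chosen for each facet in \<open>S\<close>. Intersecting with
    \<open>X\<close> is then a left inverse of \<open>f\<close> on \<open>S\<close>.\<close>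
  have "\<forall>F\<in>S. \<exists>G. G \<in> facets \<Delta> \<and> G \<inter> X = F"
    using S facet_induced_extends[OF complex] by (metis subsetD)
  then obtain f where f: "\<And>F. F \<in> S \<Longrightarrow> f F \<in> facets \<Delta>" "\<And>F. F \<in> S \<Longrightarrow> f F \<inter> X = F"
    by metis
  have sub: "f ` S \<subseteq> facets \<Delta>"
    using f(1) by blast
  then obtain L where L: "leaf (generated_complex (f ` S)) L"
    using assms(1) S unfolding simplicial_forest_def by (metis image_is_empty)
  then obtain F where F: "F \<in> S" "L = f F"
    unfolding leaf_def facets_generated_complex[OF sub] by blast
  have "S = {F} \<or> (\<exists>G\<in>S. G \<noteq> F \<and> (\<forall>H\<in>S. H \<noteq> F \<longrightarrow> F \<inter> H \<subseteq> G))"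
  \<comment> \<open>The two cases are the two alternatives in the definition of
    \<open>leaf\<close>.\<close>
  proof (cases "f ` S = {f F}")
    case True
    have "G = F" if "G \<in> S" for G
      using True that F(1) f(2) by (metis imageI singletonD)
    then show ?thesis
      using F(1) by blast
  next
    case False
    then have "\<exists>G\<in>f ` S. G \<noteq> f F \<and> (\<forall>H\<in>f ` S. H \<noteq> f F \<longrightarrow> f F \<inter> H \<subseteq> G)"
      using L unfolding leaf_def facets_generated_complex[OF sub] F(2) by simp
    then obtain G where G: "G \<in> S" "f G \<noteq> f F"
      and joint: "\<And>H. H \<in> S \<Longrightarrow> f H \<noteq> f F \<Longrightarrow> f F \<inter> f H \<subseteq> f G"
      by auto
    have "F \<inter> H \<subseteq> G" if "H \<in> S" "H \<noteq> F" for H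
    proof -
      have "f H \<noteq> f F"
        using that F(1) f(2) by metis
      \<comment> \<open>Here F \<inter> H = f F \<inter> f H \<inter> X \<subseteq> f G \<inter> X =
        G.\<close>
      then show ?thesis
        using joint[OF that(1)] f(2)[OF F(1)] f(2)[OF that(1)] f(2)[OF G(1)] by blast
    qed
    moreover have "G \<noteq> F"
      using G(2) by blast
    ultimately show ?thesis
      using G(1) by blast
  qed
  \<comment> \<open>Now the facet computation is used inside the induced subcomplex, turning the
    alternative just shown for \<open>S\<close> into the statement that \<open>F\<close> is a
    leaf.\<close>
  moreover have "facets (generated_complex S) = S"
    using S by (intro facets_generated_complex) blast
  ultimately show "\<exists>F. leaf (generated_complex S) F"
    using F(1) unfolding leaf_def by metis
qed

theorem theorem2p5:
  fixes V X :: "'a set" and \<Delta> :: "'a set set"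
  assumes "simplicial_tree V \<Delta>"
    and "X \<subseteq> V"
  shows "simplicial_forest X (induced_subcomplex \<Delta> X)"
  using assms simplicial_forest_induced unfolding simplicial_tree_def by blast

end
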